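(* Let $(G,P)$ and $(H,S)$ be quasi-lattice ordered groups, let $N,M\ge1$, and let $\alpha\colon H\to\mathrm{Aut}(G)$ be an action such that $\alpha|_S$ restricts to automorphisms of $P$, i.e. $\alpha_s|_P\in\mathrm{Aut}(P)$ for all $s\in S$. Let $\vartheta_N\colon(G,P)\to(\mathbb{Z}^N,\mathbb{Z}_+^N)$ and $\vartheta_M\colon(H,S)\to(\mathbb{Z}^M,\mathbb{Z}_+^M)$ be controlled maps. If $\vartheta_N$ and $\vartheta_M$ have the minimality property and $\vartheta_N\alpha_h=\vartheta_N$ for all $h\in H$, then the induced map $$\vartheta\colon(G\rtimes_\alpha H,P\rtimes_\alpha S)\to(\mathbb{Z}^{N+M},\mathbb{Z}_+^{N+M}),\qquad \vartheta(gh)=(\vartheta_N(g),\vartheta_M(h)),$$ satisfies the ($\mathbb{Z}_+^{N+M}$-)minimality property.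
   Context: For a subsemigroup $P$ of a discrete group $G$ with $P\cap P^{-1}=\{e\}$ write $g\le h$ iff $g^{-1}h\in P$. $(G,P)$ is a quasi-lattice ordered group if any two $p,q\in G$ with a common upper bound in $P$ have a least common upper bound $p\vee q$ in $P$; write $p\vee q=\infty$ if $p,q$ have no common upper bound in $P$, and $p\vee q<\infty$ otherwise. In $(\mathbb{Z}^N,\mathbb{Z}_+^N)$ the order is coordinatewise. A controlled map $\vartheta\colon(G,P)\to(\mathbb{Z}^N,\mathbb{Z}_+^N)$ is an order preserving group homomorphism $G\to\mathbb{Z}^N$ such that $\vartheta|_P$ is finite-to-one, and $\vartheta(p)\vee\vartheta(q)=\vartheta(p\vee q)$ for all $p,q\in P$ with $p\vee q<\infty$. It has the minimality property if for every $\underline{m}\in\mathbb{Z}_+^N$, whenever $p\ne q$ are minimal elements of $\vartheta^{-1}([\underline{m},\infty]):=\{r\in P:\vartheta(r)\ge\underline{m}\}$, then $p\vee q=\infty$. The semidirect product $G\rtimes_\alpha H$ is formed with respect to the relations $\alpha_h(g)h=hg$; each of its elements is uniquely of the form $gh$ with $g\in G$, $h\in H$, and $P\rtimes_\alpha S=P\cdot S=\{ps:p\in P,s\in S\}$, a subsemigroup. The pair $(G\rtimes_\alpha H,P\rtimes_\alpha S)$ is a quasi-lattice ordered group. *)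

theory Defs
  imports "HOL-Algebra.Algebra"
begin

section \<open>Quasi-lattice ordered groups\<close>

definition left_le :: "('a, 'b) monoid_scheme \<Rightarrow> 'a set \<Rightarrow> 'a \<Rightarrow> 'a \<Rightarrow> bool"
  where "left_le G P g h \<longleftrightarrow> inv\<^bsub>G\<^esub> g \<otimes>\<^bsub>G\<^esub> h \<in> P"

definition common_upper_bounds :: "('a, 'b) monoid_scheme \<Rightarrow> 'a set \<Rightarrow> 'a \<Rightarrow> 'a \<Rightarrow> 'a set"
  where "common_upper_bounds G P p q = {r \<in> P. left_le G P p r \<and> left_le G P q r}"

definition is_join :: "('a, 'b) monoid_scheme \<Rightarrow> 'a set \<Rightarrow> 'a \<Rightarrow> 'a \<Rightarrow> 'a \<Rightarrow> bool"
  where "is_join G P p q r \<longleftrightarrow> r \<in> common_upper_bounds G P p q \<and>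
           (\<forall>t \<in> common_upper_bounds G P p q. left_le G P r t)"

text \<open>
  The value of \<open>qjoin\<close> is only meaningful when a common upper bound in \<open>P\<close> exists; otherwise
  the join is infinite, which is expressed by \<open>join_infinite\<close>.
\<close>

definition qjoin :: "('a, 'b) monoid_scheme \<Rightarrow> 'a set \<Rightarrow> 'a \<Rightarrow> 'a \<Rightarrow> 'a"
  where "qjoin G P p q = (THE r. is_join G P p q r)"

definition join_infinite :: "('a, 'b) monoid_scheme \<Rightarrow> 'a set \<Rightarrow> 'a \<Rightarrow> 'a \<Rightarrow> bool"
  where "join_infinite G P p q \<longleftrightarrow> common_upper_bounds G P p q = {}"

locale quasi_lattice_ordered_group = group G
  for G :: "('a, 'b) monoid_scheme" (structure) and P :: "'a set" +
  assumes cone_subset: "P \<subseteq> carrier G"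
    and cone_mult_closed: "\<lbrakk>p \<in> P; q \<in> P\<rbrakk> \<Longrightarrow> p \<otimes> q \<in> P"
    and cone_pointed: "P \<inter> set_inv P = {\<one>}"
    and ex_join: "\<lbrakk>p \<in> carrier G; q \<in> carrier G; \<not> join_infinite G P p q\<rbrakk>
                    \<Longrightarrow> \<exists>r. is_join G P p q r"
begin

lemma left_le_antisym:
  assumes "g \<in> carrier G" "h \<in> carrier G" "left_le G P g h" "left_le G P h g"
  shows "g = h"
proof -
  have "inv g \<otimes> h = inv (inv h \<otimes> g)"
    using assms by (simp add: inv_mult_group)
  then have "inv g \<otimes> h \<in> P \<inter> set_inv P"
    using assms unfolding left_le_def SET_INV_def by auto
  then have "inv g \<otimes> h = \<one>"
    using cone_pointed by auto
  then show ?thesis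
    using assms by (metis inv_closed inv_equality inv_inv)
qed

lemma is_join_qjoin:
  assumes "p \<in> carrier G" "q \<in> carrier G" "\<not> join_infinite G P p q"
  shows "is_join G P p q (qjoin G P p q)"
proof -
  obtain r where r: "is_join G P p q r"
    using ex_join assms by blast
  have "s = r" if "is_join G P p q s" for s
    using left_le_antisym[of s r] that r cone_subset
    unfolding is_join_def common_upper_bounds_def by blast
  with r show ?thesis
    unfolding qjoin_def by (rule theI[of "is_join G P p q"])
qed

end

section \<open>The groups of integer vectors\<close>

definition int_vec_group :: "nat \<Rightarrow> (nat \<Rightarrow> int) monoid"
  where "int_vec_group N = product_group {..<N} (\<lambda>_. integer_group)"

definition int_vec_cone :: "nat \<Rightarrow> (nat \<Rightarrow> int) set"
  where "int_vec_cone N = {..<N} \<rightarrow>\<^sub>E {0..}"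

lemma group_int_vec_group: "group (int_vec_group N)"
  unfolding int_vec_group_def by simp

lemma left_le_int_vec:
  assumes "x \<in> carrier (int_vec_group N)" "y \<in> carrier (int_vec_group N)"
  shows "left_le (int_vec_group N) (int_vec_cone N) x y \<longleftrightarrow> (\<forall>i<N. x i \<le> y i)"
  using assms
  by (auto simp: left_le_def int_vec_group_def int_vec_cone_def PiE_iff)

lemma is_join_int_vec:
  assumes "x \<in> int_vec_cone N" "y \<in> int_vec_cone N"
  shows "is_join (int_vec_group N) (int_vec_cone N) x y (\<lambda>i\<in>{..<N}. max (x i) (y i))"
proof -
  have sub: "int_vec_cone N \<subseteq> carrier (int_vec_group N)"
    by (auto simp: int_vec_cone_def int_vec_group_def PiE_iff)
  have mem: "(\<lambda>i\<in>{..<N}. max (x i) (y i)) \<in> int_vec_cone N"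
    using assms by (auto simp: int_vec_cone_def PiE_iff max_def)
  show ?thesis
    using assms mem sub
    by (auto simp: is_join_def common_upper_bounds_def left_le_int_vec subset_iff)
qed

lemma quasi_lattice_ordered_int_vec:
  "quasi_lattice_ordered_group (int_vec_group N) (int_vec_cone N)"
proof -
  interpret group "int_vec_group N" by (rule group_int_vec_group)
  have sub: "int_vec_cone N \<subseteq> carrier (int_vec_group N)"
    by (auto simp: int_vec_cone_def int_vec_group_def PiE_iff)
  show ?thesis
  proof
    show "int_vec_cone N \<inter> set_inv\<^bsub>int_vec_group N\<^esub> int_vec_cone N = {\<one>\<^bsub>int_vec_group N\<^esub>}"
    proof (intro equalityI subsetI)
      fix x assume "x \<in> int_vec_cone N \<inter> set_inv\<^bsub>int_vec_group N\<^esub> int_vec_cone N"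
      then obtain y where xy: "x \<in> int_vec_cone N" "y \<in> int_vec_cone N"
        "x = inv\<^bsub>int_vec_group N\<^esub> y"
        by (auto simp: SET_INV_def)
      have inv: "inv\<^bsub>int_vec_group N\<^esub> y = (\<lambda>i\<in>{..<N}. - y i)"
        using xy(2) by (auto simp: int_vec_group_def int_vec_cone_def PiE_iff)
      have "x i = (if i < N then 0 else undefined)" for i
      proof (cases "i < N")
        case True
        then have "x i = - y i" "x i \<ge> 0" "y i \<ge> 0"
          using xy inv by (auto simp: int_vec_cone_def PiE_iff)
        then show ?thesis using True by simp
      qed (use xy in \<open>auto simp: int_vec_cone_def PiE_iff extensional_def\<close>)
      then show "x \<in> {\<one>\<^bsub>int_vec_group N\<^esub>}"
        by (auto simp: int_vec_group_def)
    next
      fix x assume "x \<in> {\<one>\<^bsub>int_vec_group N\<^esub>}"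
      moreover have "\<one>\<^bsub>int_vec_group N\<^esub> \<in> int_vec_cone N"
        by (auto simp: int_vec_group_def int_vec_cone_def)
      moreover have "\<one>\<^bsub>int_vec_group N\<^esub> = inv\<^bsub>int_vec_group N\<^esub> \<one>\<^bsub>int_vec_group N\<^esub>"
        by simp
      ultimately show "x \<in> int_vec_cone N \<inter> set_inv\<^bsub>int_vec_group N\<^esub> int_vec_cone N"
        unfolding SET_INV_def by blast
    qed
    fix p q
    show "p \<otimes>\<^bsub>int_vec_group N\<^esub> q \<in> int_vec_cone N"
      if "p \<in> int_vec_cone N" "q \<in> int_vec_cone N"
      using that by (auto simp: int_vec_group_def int_vec_cone_def PiE_iff)
    assume pq: "p \<in> carrier (int_vec_group N)" "q \<in> carrier (int_vec_group N)"
    let ?r = "\<lambda>i\<in>{..<N}. max 0 (max (p i) (q i))"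
    have "?r \<in> int_vec_cone N"
      by (auto simp: int_vec_cone_def)
    moreover have "t i \<ge> 0" if "t \<in> int_vec_cone N" "i < N" for t i
      using that by (auto simp: int_vec_cone_def PiE_iff)
    ultimately have "is_join (int_vec_group N) (int_vec_cone N) p q ?r"
      using pq sub
      by (auto simp: is_join_def common_upper_bounds_def left_le_int_vec subset_iff)
    then show "\<exists>r. is_join (int_vec_group N) (int_vec_cone N) p q r"
      by (rule exI[of _ ?r])
  qed (rule sub)
qed

text \<open>The identification of \<open>\<int>\<^sup>N \<times> \<int>\<^sup>M\<close> with \<open>\<int>\<^sup>N\<^sup>+\<^sup>M\<close> by concatenation.\<close>

definition vec_append :: "nat \<Rightarrow> nat \<Rightarrow> (nat \<Rightarrow> int) \<Rightarrow> (nat \<Rightarrow> int) \<Rightarrow> nat \<Rightarrow> int"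
  where "vec_append N M x y = (\<lambda>i\<in>{..<N + M}. if i < N then x i else y (i - N))"

section \<open>Controlled maps and the minimality property\<close>

definition controlled_map ::
    "('a, 'b) monoid_scheme \<Rightarrow> 'a set \<Rightarrow> nat \<Rightarrow> ('a \<Rightarrow> nat \<Rightarrow> int) \<Rightarrow> bool"
  where "controlled_map G P N \<theta> \<longleftrightarrow>
    \<theta> \<in> hom G (int_vec_group N) \<and>
    (\<forall>g \<in> carrier G. \<forall>h \<in> carrier G. left_le G P g h \<longrightarrow>
        left_le (int_vec_group N) (int_vec_cone N) (\<theta> g) (\<theta> h)) \<and>
    (\<forall>x \<in> carrier (int_vec_group N). finite {p \<in> P. \<theta> p = x}) \<and>
    (\<forall>p \<in> P. \<forall>q \<in> P. \<not> join_infinite G P p q \<longrightarrow>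
        qjoin (int_vec_group N) (int_vec_cone N) (\<theta> p) (\<theta> q) = \<theta> (qjoin G P p q))"

definition minimal_elements :: "('a, 'b) monoid_scheme \<Rightarrow> 'a set \<Rightarrow> 'a set \<Rightarrow> 'a set"
  where "minimal_elements G P A = {p \<in> A. \<forall>q \<in> A. left_le G P q p \<longrightarrow> q = p}"

definition upper_preimage ::
    "'a set \<Rightarrow> nat \<Rightarrow> ('a \<Rightarrow> nat \<Rightarrow> int) \<Rightarrow> (nat \<Rightarrow> int) \<Rightarrow> 'a set"
  where "upper_preimage P N \<theta> m =
    {r \<in> P. left_le (int_vec_group N) (int_vec_cone N) m (\<theta> r)}"

definition minimality_property ::
    "('a, 'b) monoid_scheme \<Rightarrow> 'a set \<Rightarrow> nat \<Rightarrow> ('a \<Rightarrow> nat \<Rightarrow> int) \<Rightarrow> bool"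
  where "minimality_property G P N \<theta> \<longleftrightarrow>
    (\<forall>m \<in> int_vec_cone N.
       \<forall>p \<in> minimal_elements G P (upper_preimage P N \<theta> m).
       \<forall>q \<in> minimal_elements G P (upper_preimage P N \<theta> m).
         p \<noteq> q \<longrightarrow> join_infinite G P p q)"

section \<open>Semidirect products\<close>

text \<open>
  The pair \<open>(g, h)\<close> stands for the product \<open>gh\<close>, so that the relation \<open>\<alpha>\<^sub>h(g)h = hg\<close> gives
  \<open>gh \<cdot> g'h' = g\<alpha>\<^sub>h(g') \<cdot> hh'\<close>.
  Under this identification the subsemigroup \<open>P \<cdot> S\<close> is the set \<open>P \<times> S\<close>.
\<close>

definition semidirect_product ::
    "('a, 'c) monoid_scheme \<Rightarrow> ('b, 'd) monoid_scheme \<Rightarrow> ('b \<Rightarrow> 'a \<Rightarrow> 'a) \<Rightarrow> ('a \<times> 'b) monoid"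
  where "semidirect_product G H \<alpha> =
    \<lparr>carrier = carrier G \<times> carrier H,
     monoid.mult = (\<lambda>(g, h) (g', h'). (g \<otimes>\<^bsub>G\<^esub> \<alpha> h g', h \<otimes>\<^bsub>H\<^esub> h')),
     one = (\<one>\<^bsub>G\<^esub>, \<one>\<^bsub>H\<^esub>)\<rparr>"

lemma group_semidirect_product:
  assumes G: "group G" and H: "group H" and \<alpha>: "\<alpha> \<in> hom H (AutoGroup G)"
  shows "group (semidirect_product G H \<alpha>)"
proof -
  interpret G: group G by fact
  interpret H: group H by fact
  interpret A: group "AutoGroup G" by (rule G.AutoGroup)
  have auto: "\<alpha> h \<in> auto G" if "h \<in> carrier H" for h
    using that \<alpha> by (auto simp: hom_def AutoGroup_def)
  have homG: "\<alpha> h \<in> hom G G" and bij: "\<alpha> h \<in> Bij (carrier G)" if "h \<in> carrier H" for h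
    using auto[OF that] by (auto simp: auto_def)
  have closed: "\<alpha> h g \<in> carrier G" if "h \<in> carrier H" "g \<in> carrier G" for h g
    using homG that by (auto simp: hom_def)
  have mult: "\<alpha> h (x \<otimes>\<^bsub>G\<^esub> y) = \<alpha> h x \<otimes>\<^bsub>G\<^esub> \<alpha> h y"
    if "h \<in> carrier H" "x \<in> carrier G" "y \<in> carrier G" for h x y
    using homG that by (auto simp: hom_def)
  have comp: "\<alpha> (h \<otimes>\<^bsub>H\<^esub> k) g = \<alpha> h (\<alpha> k g)"
    if "h \<in> carrier H" "k \<in> carrier H" "g \<in> carrier G" for h k g
    using hom_mult[OF \<alpha>, of h k] that bij
    by (simp add: AutoGroup_def BijGroup_def compose_def)
  have one: "\<alpha> \<one>\<^bsub>H\<^esub> g = g" if "g \<in> carrier G" for g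
    using hom_one[OF \<alpha> H A.is_group] that by (simp add: AutoGroup_def BijGroup_def)
  show ?thesis
  proof (rule groupI)
    fix x assume "x \<in> carrier (semidirect_product G H \<alpha>)"
    then obtain g h where x: "x = (g, h)" "g \<in> carrier G" "h \<in> carrier H"
      by (auto simp: semidirect_product_def)
    let ?y = "(\<alpha> (inv\<^bsub>H\<^esub> h) (inv\<^bsub>G\<^esub> g), inv\<^bsub>H\<^esub> h)"
    have "\<alpha> (inv\<^bsub>H\<^esub> h) (inv\<^bsub>G\<^esub> g) \<otimes>\<^bsub>G\<^esub> \<alpha> (inv\<^bsub>H\<^esub> h) g = \<one>\<^bsub>G\<^esub>"
      using x mult[of "inv\<^bsub>H\<^esub> h" "inv\<^bsub>G\<^esub> g" g] hom_one[OF homG G G, of "inv\<^bsub>H\<^esub> h"]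
      by (metis G.inv_closed G.l_inv H.inv_closed)
    then show "\<exists>y \<in> carrier (semidirect_product G H \<alpha>).
        y \<otimes>\<^bsub>semidirect_product G H \<alpha>\<^esub> x = \<one>\<^bsub>semidirect_product G H \<alpha>\<^esub>"
      using x closed[of "inv\<^bsub>H\<^esub> h" "inv\<^bsub>G\<^esub> g"]
      by (intro bexI[of _ ?y]) (auto simp: semidirect_product_def)
  qed (auto simp: semidirect_product_def closed mult comp one G.m_assoc H.m_assoc)
qed

definition induced_map ::
    "nat \<Rightarrow> nat \<Rightarrow> ('a \<Rightarrow> nat \<Rightarrow> int) \<Rightarrow> ('b \<Rightarrow> nat \<Rightarrow> int) \<Rightarrow> 'a \<times> 'b \<Rightarrow> nat \<Rightarrow> int"
  where "induced_map N M \<theta>\<^sub>N \<theta>\<^sub>M = (\<lambda>(g, h). vec_append N M (\<theta>\<^sub>N g) (\<theta>\<^sub>M h))"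

end

theory Submission
  imports Defs
begin

text \<open>
  Since every \<open>\<alpha>\<^sub>s\<close> with \<open>s \<in> S\<close> maps \<open>P\<close> onto \<open>P\<close>, the twist by \<open>\<alpha>\<close> is invisible to the order
  once the smaller element has its second coordinate in \<open>S\<close>: there
  \<open>(g, s)\<^sup>-\<^sup>1(g', h') = (\<alpha>\<^sub>s\<^sup>-\<^sup>1(g\<^sup>-\<^sup>1g'), s\<^sup>-\<^sup>1h')\<close>, and the first entry lies in \<open>P\<close> exactly when
  \<open>g\<^sup>-\<^sup>1g'\<close> does (\<open>left_le_semidirect\<close>).  So \<open>P \<rtimes> S\<close> carries the product order of \<open>P\<close> and \<open>S\<close>.
  The same holds for \<open>\<int>\<^sup>N\<^sup>+\<^sup>M\<close> as a product of \<open>\<int>\<^sup>N\<close> and \<open>\<int>\<^sup>M\<close>, and in product orders everything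
  splits: common upper bounds and joins are formed in each coordinate, an upper preimage is the
  product of the two upper preimages, and a minimal element of it has minimal coordinates
  (\<open>minimal_elements_semidirect\<close>).  Two distinct minimal elements differ in some coordinate, where
  their entries have no common upper bound; hence they have none themselves.

  Outside \<open>P \<rtimes> S\<close> the order need not be the product order, because \<open>\<alpha>\<^sub>h\<close> may move \<open>P\<close> when \<open>h\<close> is
  not in \<open>S\<close>.  That the induced map is a homomorphism and preserves the order on the whole group
  rests on the invariance \<open>\<theta>\<^sub>N \<alpha>\<^sub>h = \<theta>\<^sub>N\<close>, which removes the twist in the target
  (\<open>left_le_induced_map\<close>).
\<close>

section \<open>Joins and controlled maps\<close>

text \<open>
  Two joins lie below each other, so antisymmetry on the cone makes the join unique.  Stated for an
  arbitrary cone, this covers the integer vectors and the semidirect product alike.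
\<close>

lemma qjoin_eqI:
  assumes "is_join G P p q r"
    and "\<And>x y. \<lbrakk>x \<in> P; y \<in> P; left_le G P x y; left_le G P y x\<rbrakk> \<Longrightarrow> x = y"
  shows "qjoin G P p q = r"
  unfolding qjoin_def
  using assms by (intro the_equality) (auto simp: is_join_def common_upper_bounds_def)

context quasi_lattice_ordered_group
begin

lemma one_in_cone: "\<one> \<in> P"
  using cone_pointed by auto

lemma left_le_refl: "g \<in> carrier G \<Longrightarrow> left_le G P g g"
  by (simp add: left_le_def one_in_cone)

end

lemma int_vec_cone_subset: "int_vec_cone N \<subseteq> carrier (int_vec_group N)"
  using quasi_lattice_ordered_int_vec quasi_lattice_ordered_group.cone_subset by blast

lemma qjoin_int_vec:
  assumes "x \<in> int_vec_cone N" "y \<in> int_vec_cone N"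
  shows "qjoin (int_vec_group N) (int_vec_cone N) x y = (\<lambda>i\<in>{..<N}. max (x i) (y i))"
proof (rule qjoin_eqI[OF is_join_int_vec[OF assms]])
  fix u v
  assume "u \<in> int_vec_cone N" "v \<in> int_vec_cone N"
    "left_le (int_vec_group N) (int_vec_cone N) u v" "left_le (int_vec_group N) (int_vec_cone N) v u"
  then show "u = v"
    using quasi_lattice_ordered_group.left_le_antisym[OF quasi_lattice_ordered_int_vec]
      int_vec_cone_subset by blast
qed

lemma controlled_map_closed:
  assumes "controlled_map G P N \<theta>" "g \<in> carrier G"
  shows "\<theta> g \<in> carrier (int_vec_group N)"
  using assms by (auto simp: controlled_map_def hom_def)

text \<open>
  An element of the cone lies above the identity, so order preservation puts its image above \<open>0\<close>.
\<close>

lemma controlled_map_cone: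
  assumes "quasi_lattice_ordered_group G P" "controlled_map G P N \<theta>" "p \<in> P"
  shows "\<theta> p \<in> int_vec_cone N"
proof -
  interpret quasi_lattice_ordered_group G P by fact
  interpret V: group "int_vec_group N" by (rule group_int_vec_group)
  have p: "p \<in> carrier G" using assms cone_subset by auto
  have "left_le G P \<one>\<^bsub>G\<^esub> p" using p assms by (simp add: left_le_def)
  then have "left_le (int_vec_group N) (int_vec_cone N) (\<theta> \<one>\<^bsub>G\<^esub>) (\<theta> p)"
    using assms p by (auto simp: controlled_map_def)
  moreover have "\<theta> \<one>\<^bsub>G\<^esub> = \<one>\<^bsub>int_vec_group N\<^esub>"
    using assms(2) hom_one[OF _ is_group V.is_group] by (auto simp: controlled_map_def)
  ultimately show ?thesis
    using controlled_map_closed[OF assms(2) p] by (simp add: left_le_def)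
qed

section \<open>Concatenation of integer vectors\<close>

lemma vec_append_closed: "vec_append N M x y \<in> carrier (int_vec_group (N + M))"
  by (auto simp: vec_append_def int_vec_group_def)

lemma vec_append_nth:
  "i < N \<Longrightarrow> vec_append N M x y i = x i"
  "j < M \<Longrightarrow> vec_append N M x y (N + j) = y j"
  by (auto simp: vec_append_def)

lemma all_less_add_iff:
  "(\<forall>i < N + M. Q i) \<longleftrightarrow> (\<forall>i < N. Q i) \<and> (\<forall>j < M. Q (N + j))" for N M :: nat
proof (intro iffI allI impI)
  fix i assume Q: "(\<forall>i < N. Q i) \<and> (\<forall>j < M. Q (N + j))" and i: "i < N + M"
  show "Q i"
  proof (cases "i < N")
    case False
    then have "i = N + (i - N)" "i - N < M" using i by auto
    then show ?thesis using Q by metis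
  qed (use Q in simp)
qed simp

lemma int_vec_eqI:
  assumes "x \<in> carrier (int_vec_group N)" "y \<in> carrier (int_vec_group N)" "\<And>i. i < N \<Longrightarrow> x i = y i"
  shows "x = y"
  using assms by (auto simp: int_vec_group_def intro: PiE_ext)

lemma left_le_vec_append:
  assumes "x \<in> carrier (int_vec_group N)" "x' \<in> carrier (int_vec_group N)"
    and "y \<in> carrier (int_vec_group M)" "y' \<in> carrier (int_vec_group M)"
  shows "left_le (int_vec_group (N + M)) (int_vec_cone (N + M)) (vec_append N M x y) (vec_append N M x' y')
    \<longleftrightarrow> left_le (int_vec_group N) (int_vec_cone N) x x' \<and> left_le (int_vec_group M) (int_vec_cone M) y y'"
  using assms by (simp add: left_le_int_vec vec_append_closed all_less_add_iff vec_append_nth)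

lemma vec_append_inject:
  assumes "x \<in> carrier (int_vec_group N)" "x' \<in> carrier (int_vec_group N)"
    and "y \<in> carrier (int_vec_group M)" "y' \<in> carrier (int_vec_group M)"
  shows "vec_append N M x y = vec_append N M x' y' \<longleftrightarrow> x = x' \<and> y = y'"
proof
  assume eq: "vec_append N M x y = vec_append N M x' y'"
  have "x i = x' i" if "i < N" for i
    using fun_cong[OF eq, of i] that by (simp add: vec_append_nth)
  moreover have "y j = y' j" if "j < M" for j
    using fun_cong[OF eq, of "N + j"] that by (simp add: vec_append_nth)
  ultimately show "x = x' \<and> y = y'"
    using assms int_vec_eqI by blast
qed simp

lemma vec_append_cone:
  "x \<in> int_vec_cone N \<Longrightarrow> y \<in> int_vec_cone M \<Longrightarrow> vec_append N M x y \<in> int_vec_cone (N + M)"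
  by (auto simp: vec_append_def int_vec_cone_def PiE_iff)

lemma vec_append_mult:
  "vec_append N M (x \<otimes>\<^bsub>int_vec_group N\<^esub> x') (y \<otimes>\<^bsub>int_vec_group M\<^esub> y')
    = vec_append N M x y \<otimes>\<^bsub>int_vec_group (N + M)\<^esub> vec_append N M x' y'"
  by (rule ext) (auto simp: vec_append_def int_vec_group_def)

lemma vec_append_max:
  "(\<lambda>i\<in>{..<N + M}. max (vec_append N M x y i) (vec_append N M x' y' i))
    = vec_append N M (\<lambda>i\<in>{..<N}. max (x i) (x' i)) (\<lambda>i\<in>{..<M}. max (y i) (y' i))"
  by (rule ext) (auto simp: vec_append_def)

lemma int_vec_cone_split:
  assumes "m \<in> int_vec_cone (N + M)"
  obtains x y where "x \<in> int_vec_cone N" "y \<in> int_vec_cone M" "m = vec_append N M x y"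
proof
  show "(\<lambda>i\<in>{..<N}. m i) \<in> int_vec_cone N" "(\<lambda>j\<in>{..<M}. m (N + j)) \<in> int_vec_cone M"
    using assms by (auto simp: int_vec_cone_def PiE_iff)
  show "m = vec_append N M (\<lambda>i\<in>{..<N}. m i) (\<lambda>j\<in>{..<M}. m (N + j))"
    using assms by (auto simp: int_vec_cone_def vec_append_def PiE_iff extensional_def)
qed

section \<open>The order on a semidirect product\<close>

locale cone_preserving_action =
  G: quasi_lattice_ordered_group G P + H: quasi_lattice_ordered_group H S
  for G :: "('g, 'c) monoid_scheme" and P :: "'g set"
    and H :: "('h, 'd) monoid_scheme" and S :: "'h set" +
  fixes \<alpha> :: "'h \<Rightarrow> 'g \<Rightarrow> 'g"
  assumes action: "\<alpha> \<in> hom H (AutoGroup G)"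
    and cone_auto: "s \<in> S \<Longrightarrow> restrict (\<alpha> s) P \<in> auto (G\<lparr>carrier := P\<rparr>)"
begin

abbreviation K :: "('g \<times> 'h) monoid"
  where "K \<equiv> semidirect_product G H \<alpha>"

lemma group_K: "group K"
  by (rule group_semidirect_product[OF G.is_group H.is_group action])

lemma action_hom: "h \<in> carrier H \<Longrightarrow> \<alpha> h \<in> hom G G"
  and action_Bij: "h \<in> carrier H \<Longrightarrow> \<alpha> h \<in> Bij (carrier G)"
  using action by (auto simp: hom_def AutoGroup_def auto_def)

lemma action_closed: "h \<in> carrier H \<Longrightarrow> g \<in> carrier G \<Longrightarrow> \<alpha> h g \<in> carrier G"
  using action_hom by (auto simp: hom_def)

lemma action_comp:
  assumes "h \<in> carrier H" "k \<in> carrier H" "g \<in> carrier G"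
  shows "\<alpha> (h \<otimes>\<^bsub>H\<^esub> k) g = \<alpha> h (\<alpha> k g)"
  using hom_mult[OF action, of h k] assms action_Bij
  by (simp add: AutoGroup_def BijGroup_def compose_def)

lemma action_one: "g \<in> carrier G \<Longrightarrow> \<alpha> \<one>\<^bsub>H\<^esub> g = g"
  using hom_one[OF action H.is_group G.AutoGroup] by (simp add: AutoGroup_def BijGroup_def)

lemma action_cancel:
  assumes "h \<in> carrier H" "g \<in> carrier G"
  shows "\<alpha> h (\<alpha> (inv\<^bsub>H\<^esub> h) g) = g" "\<alpha> (inv\<^bsub>H\<^esub> h) (\<alpha> h g) = g"
  using assms by (simp_all flip: action_comp add: action_one)

lemma action_image_cone: "s \<in> S \<Longrightarrow> \<alpha> s ` P = P"
  using cone_auto[of s] by (auto simp: auto_def Bij_def bij_betw_def)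

text \<open>
  The automorphism \<open>\<alpha>\<^sub>s\<close> maps \<open>P\<close> onto itself, not just into itself; surjectivity is what makes
  \<open>\<alpha>\<^sub>s\<^sup>-\<^sup>1\<close> preserve \<open>P\<close> although \<open>s\<^sup>-\<^sup>1\<close> is usually outside \<open>S\<close>.
\<close>

lemma action_inv_cone_iff:
  assumes "s \<in> S" "g \<in> carrier G"
  shows "\<alpha> (inv\<^bsub>H\<^esub> s) g \<in> P \<longleftrightarrow> g \<in> P"
proof -
  have s: "s \<in> carrier H" using assms H.cone_subset by auto
  show ?thesis
  proof
    assume "\<alpha> (inv\<^bsub>H\<^esub> s) g \<in> P"
    then have "\<alpha> s (\<alpha> (inv\<^bsub>H\<^esub> s) g) \<in> P" using action_image_cone[OF assms(1)] by blast
    then show "g \<in> P" by (simp add: action_cancel s assms(2))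
  next
    assume "g \<in> P"
    then obtain p where "p \<in> P" "g = \<alpha> s p" using action_image_cone[OF assms(1)] by blast
    then show "\<alpha> (inv\<^bsub>H\<^esub> s) g \<in> P" using action_cancel s G.cone_subset by auto
  qed
qed

lemma inv_semidirect:
  assumes "g \<in> carrier G" "h \<in> carrier H"
  shows "inv\<^bsub>K\<^esub> (g, h) = (\<alpha> (inv\<^bsub>H\<^esub> h) (inv\<^bsub>G\<^esub> g), inv\<^bsub>H\<^esub> h)"
proof (rule group.inv_equality[OF group_K])
  have "\<alpha> (inv\<^bsub>H\<^esub> h) (inv\<^bsub>G\<^esub> g) \<otimes>\<^bsub>G\<^esub> \<alpha> (inv\<^bsub>H\<^esub> h) g = \<one>\<^bsub>G\<^esub>"
    using assms hom_mult[OF action_hom, of "inv\<^bsub>H\<^esub> h" "inv\<^bsub>G\<^esub> g" g]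
      hom_one[OF action_hom G.is_group G.is_group, of "inv\<^bsub>H\<^esub> h"]
    by simp
  then show "(\<alpha> (inv\<^bsub>H\<^esub> h) (inv\<^bsub>G\<^esub> g), inv\<^bsub>H\<^esub> h) \<otimes>\<^bsub>K\<^esub> (g, h) = \<one>\<^bsub>K\<^esub>"
    using assms by (simp add: semidirect_product_def)
qed (use assms action_closed in \<open>auto simp: semidirect_product_def\<close>)

lemma left_le_semidirect_iff_twisted:
  assumes "g \<in> carrier G" "g' \<in> carrier G" "h \<in> carrier H"
  shows "left_le K (P \<times> S) (g, h) (g', h') \<longleftrightarrow>
    \<alpha> (inv\<^bsub>H\<^esub> h) (inv\<^bsub>G\<^esub> g \<otimes>\<^bsub>G\<^esub> g') \<in> P \<and> left_le H S h h'"
  unfolding left_le_def inv_semidirect[OF assms(1,3)]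
  using assms by (simp add: semidirect_product_def hom_mult[OF action_hom])

text \<open>
  With \<open>s\<close> in \<open>S\<close>, the twist by \<open>\<alpha>\<^sub>s\<^sup>-\<^sup>1\<close> does not affect membership in \<open>P\<close>.  All that follows about
  bounds, joins and minimal elements of \<open>P \<times> S\<close> uses the order in this form only.
\<close>

lemma left_le_semidirect:
  assumes "g \<in> carrier G" "g' \<in> carrier G" "s \<in> S"
  shows "left_le K (P \<times> S) (g, s) (g', h') \<longleftrightarrow> left_le G P g g' \<and> left_le H S s h'"
proof -
  have "s \<in> carrier H" using assms H.cone_subset by auto
  then show ?thesis
    using assms left_le_semidirect_iff_twisted[of g g' s h'] action_inv_cone_iff
    by (simp add: left_le_def[of G])
qed

lemma common_upper_bounds_semidirect:
  assumes "p \<in> P" "q \<in> P" "s \<in> S" "t \<in> S"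
  shows "common_upper_bounds K (P \<times> S) (p, s) (q, t)
    = common_upper_bounds G P p q \<times> common_upper_bounds H S s t"
  using assms G.cone_subset
  by (auto simp: common_upper_bounds_def left_le_semidirect subset_iff)

lemma join_infinite_semidirect:
  assumes "p \<in> P" "q \<in> P" "s \<in> S" "t \<in> S"
  shows "join_infinite K (P \<times> S) (p, s) (q, t) \<longleftrightarrow> join_infinite G P p q \<or> join_infinite H S s t"
  by (simp add: join_infinite_def common_upper_bounds_semidirect[OF assms])

lemma qjoin_semidirect:
  assumes "p \<in> P" "q \<in> P" "s \<in> S" "t \<in> S"
    and "\<not> join_infinite K (P \<times> S) (p, s) (q, t)"
  shows "qjoin K (P \<times> S) (p, s) (q, t) = (qjoin G P p q, qjoin H S s t)"
proof (rule qjoin_eqI)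
  have "is_join G P p q (qjoin G P p q)" "is_join H S s t (qjoin H S s t)"
    using assms join_infinite_semidirect G.cone_subset H.cone_subset
    by (auto intro!: G.is_join_qjoin H.is_join_qjoin)
  then show "is_join K (P \<times> S) (p, s) (q, t) (qjoin G P p q, qjoin H S s t)"
    unfolding is_join_def common_upper_bounds_semidirect[OF assms(1-4)]
    using G.cone_subset
    by (auto simp: common_upper_bounds_def left_le_semidirect subset_iff)
next
  fix x y
  assume "x \<in> P \<times> S" "y \<in> P \<times> S" "left_le K (P \<times> S) x y" "left_le K (P \<times> S) y x"
  then show "x = y"
    using G.cone_subset H.cone_subset
    by (auto simp: left_le_semidirect subset_iff intro: G.left_le_antisym H.left_le_antisym)
qed

text \<open>
  Lowering one coordinate while keeping the other stays inside a product set and produces a smaller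
  element of it, so each coordinate of a minimal element is itself minimal.
\<close>

lemma minimal_elements_semidirect:
  assumes "A \<subseteq> P" "B \<subseteq> S"
  shows "minimal_elements K (P \<times> S) (A \<times> B) \<subseteq> minimal_elements G P A \<times> minimal_elements H S B"
proof
  fix x assume "x \<in> minimal_elements K (P \<times> S) (A \<times> B)"
  then obtain p s where x: "x = (p, s)" and mem: "p \<in> A" "s \<in> B"
    and min: "\<And>q t. q \<in> A \<Longrightarrow> t \<in> B \<Longrightarrow> left_le K (P \<times> S) (q, t) (p, s) \<Longrightarrow> q = p \<and> t = s"
    by (cases x) (auto simp: minimal_elements_def)
  have "q = p" if "q \<in> A" "left_le G P q p" for q
    using min[OF that(1) mem(2)] that mem assms G.cone_subset H.cone_subset
    by (auto simp: left_le_semidirect subset_iff H.left_le_refl)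
  moreover have "t = s" if "t \<in> B" "left_le H S t s" for t
    using min[OF mem(1) that(1)] that mem assms G.cone_subset
    by (auto simp: left_le_semidirect subset_iff G.left_le_refl)
  ultimately show "x \<in> minimal_elements G P A \<times> minimal_elements H S B"
    using x mem by (auto simp: minimal_elements_def)
qed

section \<open>The induced map\<close>

text \<open>
  The elements are arbitrary, so the order relation only says that \<open>\<alpha>\<^sub>h\<^sup>-\<^sup>1(g\<^sup>-\<^sup>1g')\<close> is in \<open>P\<close>.
  Since \<open>\<theta>\<^sub>N\<close> is invariant, it takes the same value on \<open>g\<^sup>-\<^sup>1g'\<close>, and this value is
  \<open>\<theta>\<^sub>N(g') - \<theta>\<^sub>N(g)\<close>.
\<close>

lemma left_le_induced_map:
  assumes \<theta>\<^sub>N: "controlled_map G P N \<theta>\<^sub>N" and \<theta>\<^sub>M: "controlled_map H S M \<theta>\<^sub>M"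
    and inv: "\<And>h g. h \<in> carrier H \<Longrightarrow> g \<in> carrier G \<Longrightarrow> \<theta>\<^sub>N (\<alpha> h g) = \<theta>\<^sub>N g"
    and mem: "g \<in> carrier G" "g' \<in> carrier G" "h \<in> carrier H" "h' \<in> carrier H"
    and le: "left_le K (P \<times> S) (g, h) (g', h')"
  shows "left_le (int_vec_group (N + M)) (int_vec_cone (N + M))
    (vec_append N M (\<theta>\<^sub>N g) (\<theta>\<^sub>M h)) (vec_append N M (\<theta>\<^sub>N g') (\<theta>\<^sub>M h'))"
proof -
  interpret V: group "int_vec_group N" by (rule group_int_vec_group)
  interpret \<theta>: group_hom G "int_vec_group N" \<theta>\<^sub>N
    using \<theta>\<^sub>N by unfold_locales (simp add: controlled_map_def)
  let ?d = "inv\<^bsub>G\<^esub> g \<otimes>\<^bsub>G\<^esub> g'"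
  have "\<alpha> (inv\<^bsub>H\<^esub> h) ?d \<in> P" and leH: "left_le H S h h'"
    using le mem by (auto simp: left_le_semidirect_iff_twisted)
  then have "\<theta>\<^sub>N ?d \<in> int_vec_cone N"
    using controlled_map_cone[OF G.quasi_lattice_ordered_group_axioms \<theta>\<^sub>N] inv mem
    by (metis G.inv_closed G.m_closed H.inv_closed)
  then have "left_le (int_vec_group N) (int_vec_cone N) (\<theta>\<^sub>N g) (\<theta>\<^sub>N g')"
    using mem by (simp add: left_le_def)
  moreover have "left_le (int_vec_group M) (int_vec_cone M) (\<theta>\<^sub>M h) (\<theta>\<^sub>M h')"
    using \<theta>\<^sub>M leH mem by (auto simp: controlled_map_def)
  ultimately show ?thesis
    using mem controlled_map_closed[OF \<theta>\<^sub>N] controlled_map_closed[OF \<theta>\<^sub>M]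
    by (simp add: left_le_vec_append)
qed

text \<open>
  The fibre over a vector is a product of a fibre of \<open>\<theta>\<^sub>N\<close> and one of \<open>\<theta>\<^sub>M\<close>, which gives
  finiteness.  Joins are formed coordinatewise both in \<open>P \<times> S\<close> and in \<open>\<int>\<^sup>N\<^sup>+\<^sup>M\<close>, so their
  preservation is inherited from the two factors.
\<close>

lemma controlled_map_induced:
  assumes \<theta>\<^sub>N: "controlled_map G P N \<theta>\<^sub>N" and \<theta>\<^sub>M: "controlled_map H S M \<theta>\<^sub>M"
    and inv: "\<And>h g. h \<in> carrier H \<Longrightarrow> g \<in> carrier G \<Longrightarrow> \<theta>\<^sub>N (\<alpha> h g) = \<theta>\<^sub>N g"
  shows "controlled_map K (P \<times> S) (N + M) (induced_map N M \<theta>\<^sub>N \<theta>\<^sub>M)"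
  unfolding controlled_map_def
proof (intro conjI ballI impI)
  have "\<theta>\<^sub>N \<in> hom G (int_vec_group N)" "\<theta>\<^sub>M \<in> hom H (int_vec_group M)"
    using \<theta>\<^sub>N \<theta>\<^sub>M by (auto simp: controlled_map_def)
  then show "induced_map N M \<theta>\<^sub>N \<theta>\<^sub>M \<in> hom K (int_vec_group (N + M))"
    by (auto intro!: homI simp: semidirect_product_def induced_map_def vec_append_closed
        hom_mult action_closed inv vec_append_mult)
next
  fix x y
  assume "x \<in> carrier K" "y \<in> carrier K" "left_le K (P \<times> S) x y"
  then show "left_le (int_vec_group (N + M)) (int_vec_cone (N + M))
      (induced_map N M \<theta>\<^sub>N \<theta>\<^sub>M x) (induced_map N M \<theta>\<^sub>N \<theta>\<^sub>M y)"
    using left_le_induced_map[OF \<theta>\<^sub>N \<theta>\<^sub>M inv]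
    by (auto simp: semidirect_product_def induced_map_def)
next
  fix z
  let ?F = "{r \<in> P \<times> S. induced_map N M \<theta>\<^sub>N \<theta>\<^sub>M r = z}"
  show "finite ?F"
  proof (cases "?F = {}")
    case False
    then obtain p s where ps: "p \<in> P" "s \<in> S" "z = vec_append N M (\<theta>\<^sub>N p) (\<theta>\<^sub>M s)"
      by (auto simp: induced_map_def)
    have closed: "\<theta>\<^sub>N p' \<in> carrier (int_vec_group N)" "\<theta>\<^sub>M s' \<in> carrier (int_vec_group M)"
      if "p' \<in> P" "s' \<in> S" for p' s'
      using that controlled_map_closed[OF \<theta>\<^sub>N] controlled_map_closed[OF \<theta>\<^sub>M]
        G.cone_subset H.cone_subset by auto
    have "finite {p' \<in> P. \<theta>\<^sub>N p' = \<theta>\<^sub>N p}" "finite {s' \<in> S. \<theta>\<^sub>M s' = \<theta>\<^sub>M s}"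
      using \<theta>\<^sub>N \<theta>\<^sub>M closed ps by (auto simp: controlled_map_def)
    then have "finite ({p' \<in> P. \<theta>\<^sub>N p' = \<theta>\<^sub>N p} \<times> {s' \<in> S. \<theta>\<^sub>M s' = \<theta>\<^sub>M s})" by simp
    moreover have "?F \<subseteq> {p' \<in> P. \<theta>\<^sub>N p' = \<theta>\<^sub>N p} \<times> {s' \<in> S. \<theta>\<^sub>M s' = \<theta>\<^sub>M s}"
      using ps closed by (auto simp: induced_map_def vec_append_inject)
    ultimately show ?thesis by (rule finite_subset[rotated])
  qed (metis finite.emptyI)
next
  fix x y
  assume "x \<in> P \<times> S" "y \<in> P \<times> S" and fin: "\<not> join_infinite K (P \<times> S) x y"
  then obtain p s q t where xy: "x = (p, s)" "y = (q, t)"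
    and mem: "p \<in> P" "s \<in> S" "q \<in> P" "t \<in> S" by auto
  have "\<not> join_infinite G P p q" "\<not> join_infinite H S s t"
    using fin mem by (auto simp: xy join_infinite_semidirect)
  moreover have cone: "\<theta>\<^sub>N p \<in> int_vec_cone N" "\<theta>\<^sub>N q \<in> int_vec_cone N"
    "\<theta>\<^sub>M s \<in> int_vec_cone M" "\<theta>\<^sub>M t \<in> int_vec_cone M"
    using mem controlled_map_cone[OF G.quasi_lattice_ordered_group_axioms \<theta>\<^sub>N]
      controlled_map_cone[OF H.quasi_lattice_ordered_group_axioms \<theta>\<^sub>M] by auto
  ultimately have "\<theta>\<^sub>N (qjoin G P p q) = (\<lambda>i\<in>{..<N}. max (\<theta>\<^sub>N p i) (\<theta>\<^sub>N q i))"
    "\<theta>\<^sub>M (qjoin H S s t) = (\<lambda>i\<in>{..<M}. max (\<theta>\<^sub>M s i) (\<theta>\<^sub>M t i))"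
    using \<theta>\<^sub>N \<theta>\<^sub>M mem by (auto simp: controlled_map_def simp flip: qjoin_int_vec)
  then show "qjoin (int_vec_group (N + M)) (int_vec_cone (N + M))
      (induced_map N M \<theta>\<^sub>N \<theta>\<^sub>M x) (induced_map N M \<theta>\<^sub>N \<theta>\<^sub>M y)
    = induced_map N M \<theta>\<^sub>N \<theta>\<^sub>M (qjoin K (P \<times> S) x y)"
    using fin mem cone
    by (simp add: xy qjoin_semidirect induced_map_def qjoin_int_vec vec_append_cone vec_append_max)
qed

lemma upper_preimage_induced_map:
  assumes "controlled_map G P N \<theta>\<^sub>N" "controlled_map H S M \<theta>\<^sub>M"
    and "x \<in> carrier (int_vec_group N)" "y \<in> carrier (int_vec_group M)"
  shows "upper_preimage (P \<times> S) (N + M) (induced_map N M \<theta>\<^sub>N \<theta>\<^sub>M) (vec_append N M x y)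
    = upper_preimage P N \<theta>\<^sub>N x \<times> upper_preimage S M \<theta>\<^sub>M y"
  using assms G.cone_subset H.cone_subset controlled_map_closed[OF assms(1)]
    controlled_map_closed[OF assms(2)]
  by (auto simp: upper_preimage_def induced_map_def left_le_vec_append subset_iff)

text \<open>
  The upper preimage of a concatenation is the product of the upper preimages of its two parts.
  Distinct minimal elements therefore have minimal entries that differ in some coordinate; the
  minimality property there excludes a common upper bound of those entries, hence of the pairs.
\<close>

lemma minimality_property_induced:
  assumes \<theta>\<^sub>N: "controlled_map G P N \<theta>\<^sub>N" and \<theta>\<^sub>M: "controlled_map H S M \<theta>\<^sub>M"
    and min\<^sub>N: "minimality_property G P N \<theta>\<^sub>N" and min\<^sub>M: "minimality_property H S M \<theta>\<^sub>M"
  shows "minimality_property K (P \<times> S) (N + M) (induced_map N M \<theta>\<^sub>N \<theta>\<^sub>M)"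
  unfolding minimality_property_def
proof (intro ballI impI)
  fix m u v
  assume "m \<in> int_vec_cone (N + M)"
    and u: "u \<in> minimal_elements K (P \<times> S) (upper_preimage (P \<times> S) (N + M) (induced_map N M \<theta>\<^sub>N \<theta>\<^sub>M) m)"
    and v: "v \<in> minimal_elements K (P \<times> S) (upper_preimage (P \<times> S) (N + M) (induced_map N M \<theta>\<^sub>N \<theta>\<^sub>M) m)"
    and "u \<noteq> v"
  then obtain x y where xy: "x \<in> int_vec_cone N" "y \<in> int_vec_cone M" "m = vec_append N M x y"
    using int_vec_cone_split by metis
  let ?A = "upper_preimage P N \<theta>\<^sub>N x" and ?B = "upper_preimage S M \<theta>\<^sub>M y"
  have sub: "?A \<subseteq> P" "?B \<subseteq> S" by (auto simp: upper_preimage_def)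
  have "upper_preimage (P \<times> S) (N + M) (induced_map N M \<theta>\<^sub>N \<theta>\<^sub>M) m = ?A \<times> ?B"
    using upper_preimage_induced_map[OF \<theta>\<^sub>N \<theta>\<^sub>M] xy int_vec_cone_subset by blast
  then have "u \<in> minimal_elements G P ?A \<times> minimal_elements H S ?B"
    "v \<in> minimal_elements G P ?A \<times> minimal_elements H S ?B"
    using u v minimal_elements_semidirect[OF sub] by auto
  then obtain p s q t where uv: "u = (p, s)" "v = (q, t)"
    and mins: "p \<in> minimal_elements G P ?A" "q \<in> minimal_elements G P ?A"
      "s \<in> minimal_elements H S ?B" "t \<in> minimal_elements H S ?B" by auto
  have mem: "p \<in> P" "q \<in> P" "s \<in> S" "t \<in> S"
    using mins sub by (auto simp: minimal_elements_def)
  have "p \<noteq> q \<or> s \<noteq> t" using \<open>u \<noteq> v\<close> uv by auto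
  then have "join_infinite G P p q \<or> join_infinite H S s t"
    using min\<^sub>N min\<^sub>M mins xy unfolding minimality_property_def by blast
  then show "join_infinite K (P \<times> S) u v"
    using mem by (simp add: uv join_infinite_semidirect)
qed

end

theorem proposition6p2:
  fixes G :: "('g, 'c) monoid_scheme" and P :: "'g set"
    and H :: "('h, 'd) monoid_scheme" and S :: "'h set"
    and \<alpha> :: "'h \<Rightarrow> 'g \<Rightarrow> 'g"
    and N M :: nat
    and \<theta>\<^sub>N :: "'g \<Rightarrow> nat \<Rightarrow> int" and \<theta>\<^sub>M :: "'h \<Rightarrow> nat \<Rightarrow> int"
  assumes "quasi_lattice_ordered_group G P"
    and "quasi_lattice_ordered_group H S"
    and "N \<ge> 1" and "M \<ge> 1"
    and "\<alpha> \<in> hom H (AutoGroup G)"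
    and "\<And>s. s \<in> S \<Longrightarrow> restrict (\<alpha> s) P \<in> auto (G\<lparr>carrier := P\<rparr>)"
    and "controlled_map G P N \<theta>\<^sub>N"
    and "controlled_map H S M \<theta>\<^sub>M"
    and "minimality_property G P N \<theta>\<^sub>N"
    and "minimality_property H S M \<theta>\<^sub>M"
    and "\<And>h g. h \<in> carrier H \<Longrightarrow> g \<in> carrier G \<Longrightarrow> \<theta>\<^sub>N (\<alpha> h g) = \<theta>\<^sub>N g"
  shows "controlled_map (semidirect_product G H \<alpha>) (P \<times> S) (N + M) (induced_map N M \<theta>\<^sub>N \<theta>\<^sub>M)
    \<and> minimality_property (semidirect_product G H \<alpha>) (P \<times> S) (N + M) (induced_map N M \<theta>\<^sub>N \<theta>\<^sub>M)"
proof -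
  interpret cone_preserving_action G P H S \<alpha>
    using assms(1,2,5,6)
    by (simp add: cone_preserving_action_def cone_preserving_action_axioms_def)
  show ?thesis
    using controlled_map_induced[OF assms(7,8,11)] minimality_property_induced[OF assms(7-10)]
    by blast
qed

end
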